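(* Let $C = P + \varepsilon Q$ be a reduced motion polynomial of degree $n$ and spherical degree defect $m$. Then every trajectory of $C$ (i.e. the trajectory of any point $x \in \mathbb{P}^3$), of degree $d$ and circularity $c$, satisfies $$d \le 2n - m \qquad\text{and}\qquad c \ge \frac{d-m}{2}.$$
   Context: $\mathbb{H}$ denotes the real quaternions with units $\mathbf{i},\mathbf{j},\mathbf{k}$, and $\mathbb{DH} = \mathbb{H} + \varepsilon\mathbb{H}$ the dual quaternions, where $\varepsilon^2=0$ and $\varepsilon$ commutes with everything. For $h = p + \varepsilon q$ with $p,q\in\mathbb{H}$, the conjugate is $\overline{h} = \overline{p} + \varepsilon \overline{q}$ (quaternion conjugation). In the polynomial rings $\mathbb{DH}[t]$ and $\mathbb{H}[t]$ the indeterminate $t$ commutes with all coefficients, and conjugation of polynomials is done coefficientwise. A motion polynomial is a polynomial $C = P + \varepsilon Q \in \mathbb{DH}[t]$ with $P,Q\in\mathbb{H}[t]$ whose leading coefficient is invertible (i.e. has non-zero primal part) and such that $C\overline{C}$ has real coefficients, i.e. $P\overline{Q} + Q\overline{P} = 0$. It is called reduced if $P$ and $Q$ have no common real polynomial factor of positive degree. The maximal real polynomial factor $\operatorname{mrpf} P$ of $P$ is the real polynomial of maximal degree dividing $P$ (unique up to constant factor). The spherical degree defect of $C$ is $\deg \operatorname{mrpf} P$. Points of $\mathbb{P}^3$ are represented by non-zero $x = x_0 + x_1\mathbf{i}+x_2\mathbf{j}+x_3\mathbf{k}$ with $x_0,\dots,x_3\in\mathbb{R}$, up to real scalars. The trajectory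 of $x$ under $C$ is the rational curve $t \mapsto P x \overline{P} + 2x_0 P\overline{Q}$ in $\mathbb{P}^3$. A rational parametric equation $x = x_0 + x_1\mathbf{i}+x_2\mathbf{j}+x_3\mathbf{k}$ with $x_i\in\mathbb{R}[t]$ is reduced if $\gcd(x_0,x_1,x_2,x_3)$ has degree zero; dividing by the gcd gives a reduced equation of the same curve. The degree of the curve is the maximal degree of $x_0,\dots,x_3$ in a reduced equation, and its circularity is $\frac12\deg\gcd(x_0, x_1^2+x_2^2+x_3^2)$, computed with a reduced equation. *)

theory Defs
  imports
    "HOL-Computational_Algebra.Computational_Algebra"
    "HOL-Computational_Algebra.Field_as_Ring"
begin

section \<open>Quaternions\<close>

datatype quat = Quat (qRe: real) (qI: real) (qJ: real) (qK: real)

instantiation quat :: real_algebra_1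
begin

definition "0 = Quat 0 0 0 0"
definition "1 = Quat 1 0 0 0"
definition "x + y = Quat (qRe x + qRe y) (qI x + qI y) (qJ x + qJ y) (qK x + qK y)"
definition "- x = Quat (- qRe x) (- qI x) (- qJ x) (- qK x)"
definition "x - y = Quat (qRe x - qRe y) (qI x - qI y) (qJ x - qJ y) (qK x - qK y)"
definition "r *\<^sub>R x = Quat (r * qRe x) (r * qI x) (r * qJ x) (r * qK x)"
definition "x * y = Quat
  (qRe x * qRe y - qI x * qI y - qJ x * qJ y - qK x * qK y)
  (qRe x * qI y + qI x * qRe y + qJ x * qK y - qK x * qJ y)
  (qRe x * qJ y - qI x * qK y + qJ x * qRe y + qK x * qI y)
  (qRe x * qK y + qI x * qJ y - qJ x * qI y + qK x * qRe y)"

instance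
  by standard
    (simp_all add: zero_quat_def one_quat_def plus_quat_def uminus_quat_def minus_quat_def
      scaleR_quat_def times_quat_def algebra_simps)

end

lemma quat_sel [simp]:
  "qRe 0 = 0" "qI 0 = 0" "qJ 0 = 0" "qK 0 = 0"
  "qRe 1 = 1" "qI 1 = 0" "qJ 1 = 0" "qK 1 = 0"
  "qRe (x + y) = qRe x + qRe y" "qI (x + y) = qI x + qI y"
  "qJ (x + y) = qJ x + qJ y" "qK (x + y) = qK x + qK y"
  "qRe (- x) = - qRe x" "qI (- x) = - qI x" "qJ (- x) = - qJ x" "qK (- x) = - qK x"
  "qRe (x - y) = qRe x - qRe y" "qI (x - y) = qI x - qI y"
  "qJ (x - y) = qJ x - qJ y" "qK (x - y) = qK x - qK y"
  "qRe (r *\<^sub>R x) = r * qRe x" "qI (r *\<^sub>R x) = r * qI x"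
  "qJ (r *\<^sub>R x) = r * qJ x" "qK (r *\<^sub>R x) = r * qK x"
  "qRe (x * y) = qRe x * qRe y - qI x * qI y - qJ x * qJ y - qK x * qK y"
  "qI (x * y) = qRe x * qI y + qI x * qRe y + qJ x * qK y - qK x * qJ y"
  "qJ (x * y) = qRe x * qJ y - qI x * qK y + qJ x * qRe y + qK x * qI y"
  "qK (x * y) = qRe x * qK y + qI x * qJ y - qJ x * qI y + qK x * qRe y"
  by (simp_all add: zero_quat_def one_quat_def plus_quat_def uminus_quat_def minus_quat_def
      scaleR_quat_def times_quat_def)

lemma quat_of_real: "of_real r = Quat r 0 0 0"
  by (simp add: of_real_def quat.expand)

lemma Quat_0 [simp]: "Quat 0 0 0 0 = 0"
  by (simp add: zero_quat_def)

definition qcnj :: "quat \<Rightarrow> quat" where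
  "qcnj x = Quat (qRe x) (- qI x) (- qJ x) (- qK x)"


section \<open>Dual quaternions\<close>

text \<open>\<open>DQuat p q\<close> stands for \<open>p + \<epsilon> q\<close>.\<close>

datatype dquat = DQuat (primal: quat) (dual: quat)

instantiation dquat :: real_algebra_1
begin

definition "0 = DQuat 0 0"
definition "1 = DQuat 1 0"
definition "x + y = DQuat (primal x + primal y) (dual x + dual y)"
definition "- x = DQuat (- primal x) (- dual x)"
definition "x - y = DQuat (primal x - primal y) (dual x - dual y)"
definition "r *\<^sub>R x = DQuat (r *\<^sub>R primal x) (r *\<^sub>R dual x)"
definition "x * y = DQuat (primal x * primal y) (primal x * dual y + dual x * primal y)"

instance
  by standard
    (simp_all add: zero_dquat_def one_dquat_def plus_dquat_def uminus_dquat_def minus_dquat_def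
      scaleR_dquat_def times_dquat_def algebra_simps)

end

lemma dquat_sel [simp]:
  "primal 0 = 0" "dual 0 = 0" "primal 1 = 1" "dual 1 = 0"
  "primal (x + y) = primal x + primal y" "dual (x + y) = dual x + dual y"
  "primal (- x) = - primal x" "dual (- x) = - dual x"
  "primal (x - y) = primal x - primal y" "dual (x - y) = dual x - dual y"
  "primal (r *\<^sub>R x) = r *\<^sub>R primal x" "dual (r *\<^sub>R x) = r *\<^sub>R dual x"
  "primal (x * y) = primal x * primal y"
  "dual (x * y) = primal x * dual y + dual x * primal y"
  by (simp_all add: zero_dquat_def one_dquat_def plus_dquat_def uminus_dquat_def minus_dquat_def
      scaleR_dquat_def times_dquat_def)

definition dcnj :: "dquat \<Rightarrow> dquat" where
  "dcnj h = DQuat (qcnj (primal h)) (qcnj (dual h))"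


section \<open>Polynomials over a non-commutative ring\<close>

text \<open>
  The multiplication on type \<open>poly\<close> requires commutative coefficients. The product
  below is the one for which the indeterminate commutes with all coefficients; over a
  commutative ring it agrees with \<open>(*)\<close>.
\<close>

lift_definition ncmult :: "'a::semiring_0 poly \<Rightarrow> 'a poly \<Rightarrow> 'a poly"  (infixl "\<otimes>" 70)
  is "\<lambda>p q n. \<Sum>i\<le>n. p i * q (n - i)"
proof -
  fix p q :: "nat \<Rightarrow> 'a"
  assume "\<forall>\<^sub>\<infinity>n. p n = 0" "\<forall>\<^sub>\<infinity>n. q n = 0"
  then obtain a b where a: "\<And>n. n > a \<Longrightarrow> p n = 0" and b: "\<And>n. n > b \<Longrightarrow> q n = 0"
    unfolding MOST_nat by blast
  have "(\<Sum>i\<le>n. p i * q (n - i)) = 0" if "n > a + b" for n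
  proof (rule sum.neutral, rule ballI)
    fix i assume "i \<in> {..n}"
    show "p i * q (n - i) = 0"
    proof (cases "i > a")
      case False
      then have "n - i > b" using that by linarith
      then show ?thesis using b by simp
    qed (simp add: a)
  qed
  then show "\<forall>\<^sub>\<infinity>n. (\<Sum>i\<le>n. p i * q (n - i)) = 0"
    unfolding MOST_nat by blast
qed

lemma coeff_ncmult: "coeff (p \<otimes> q) n = (\<Sum>i\<le>n. coeff p i * coeff q (n - i))"
  by transfer simp

lemma ncmult_eq_times: "p \<otimes> q = p * q" for p q :: "'a::comm_semiring_0 poly"
  by (simp add: poly_eq_iff coeff_ncmult coeff_mult)

abbreviation real_poly :: "real poly \<Rightarrow> 'a::real_algebra_1 poly" where
  "real_poly \<equiv> map_poly of_real"

abbreviation pcnj :: "quat poly \<Rightarrow> quat poly" where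
  "pcnj \<equiv> map_poly qcnj"

abbreviation primal_part :: "dquat poly \<Rightarrow> quat poly" where
  "primal_part \<equiv> map_poly primal"

abbreviation dual_part :: "dquat poly \<Rightarrow> quat poly" where
  "dual_part \<equiv> map_poly dual"

definition real_factor :: "real poly \<Rightarrow> quat poly \<Rightarrow> bool" where
  "real_factor F P \<longleftrightarrow> (\<exists>K. P = real_poly F \<otimes> K)"

text \<open>Meaningful for \<open>P \<noteq> 0\<close> only; unique up to a constant factor.\<close>

definition mrpf :: "quat poly \<Rightarrow> real poly" where
  "mrpf P = (ARG_MAX degree F. real_factor F P)"


section \<open>Motion polynomials\<close>

definition motion_polynomial :: "dquat poly \<Rightarrow> bool" where
  "motion_polynomial C \<longleftrightarrow>
     (\<exists>u. u * lead_coeff C = 1 \<and> lead_coeff C * u = 1) \<and>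
     (\<forall>i. coeff (C \<otimes> map_poly dcnj C) i \<in> \<real>)"

definition reduced_motion_polynomial :: "dquat poly \<Rightarrow> bool" where
  "reduced_motion_polynomial C \<longleftrightarrow>
     motion_polynomial C \<and>
     \<not> (\<exists>F. degree F > 0 \<and> real_factor F (primal_part C) \<and> real_factor F (dual_part C))"

definition spherical_degree_defect :: "dquat poly \<Rightarrow> nat" where
  "spherical_degree_defect C = degree (mrpf (primal_part C))"


section \<open>Rational curves in projective space\<close>

text \<open>
  A rational parametric equation \<open>x\<^sub>0 + x\<^sub>1 i + x\<^sub>2 j + x\<^sub>3 k\<close> with real polynomials
  \<open>x\<^sub>0, \<dots>, x\<^sub>3\<close>, not all zero, is a non-zero quaternion polynomial; its coordinate
  polynomials are \<open>map_poly qRe X\<close>, \<open>map_poly qI X\<close>, \<open>map_poly qJ X\<close>, \<open>map_poly qK X\<close>.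
\<close>

definition of_coords :: "real poly \<Rightarrow> real poly \<Rightarrow> real poly \<Rightarrow> real poly \<Rightarrow> quat poly" where
  "of_coords a b c d =
     map_poly (\<lambda>r. Quat r 0 0 0) a + map_poly (\<lambda>r. Quat 0 r 0 0) b +
     map_poly (\<lambda>r. Quat 0 0 r 0) c + map_poly (\<lambda>r. Quat 0 0 0 r) d"

definition coord_gcd :: "quat poly \<Rightarrow> real poly" where
  "coord_gcd X =
     gcd (map_poly qRe X) (gcd (map_poly qI X) (gcd (map_poly qJ X) (map_poly qK X)))"

definition reduce_eqn :: "quat poly \<Rightarrow> quat poly" where
  "reduce_eqn X =
     of_coords (map_poly qRe X div coord_gcd X) (map_poly qI X div coord_gcd X)
               (map_poly qJ X div coord_gcd X) (map_poly qK X div coord_gcd X)"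

definition curve_degree :: "quat poly \<Rightarrow> nat" where
  "curve_degree X =
     (let Y = reduce_eqn X
      in Max {degree (map_poly qRe Y), degree (map_poly qI Y),
              degree (map_poly qJ Y), degree (map_poly qK Y)})"

definition curve_circularity :: "quat poly \<Rightarrow> real" where
  "curve_circularity X =
     (let Y = reduce_eqn X
      in real (degree (gcd (map_poly qRe Y)
           ((map_poly qI Y)\<^sup>2 + (map_poly qJ Y)\<^sup>2 + (map_poly qK Y)\<^sup>2))) / 2)"

definition trajectory :: "dquat poly \<Rightarrow> quat \<Rightarrow> quat poly" where
  "trajectory C x =
     (let P = primal_part C; Q = dual_part C
      in P \<otimes> [:x:] \<otimes> pcnj P + [:of_real (2 * qRe x):] \<otimes> P \<otimes> pcnj Q)"


section \<open>Consistency of the definitions\<close>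

lemma invertible_dquat_iff:
  "(\<exists>u. u * h = 1 \<and> h * u = 1) \<longleftrightarrow> primal h \<noteq> 0" for h :: dquat
proof
  assume "\<exists>u. u * h = 1 \<and> h * u = 1"
  then obtain u where "u * h = 1" by blast
  then have "primal u * primal h = 1" by (metis dquat_sel(3,13))
  then show "primal h \<noteq> 0" by auto
next
  assume h: "primal h \<noteq> 0"
  let ?p = "primal h"
  let ?n = "(qRe ?p)\<^sup>2 + (qI ?p)\<^sup>2 + (qJ ?p)\<^sup>2 + (qK ?p)\<^sup>2"
  define v where "v = (1 / ?n) *\<^sub>R qcnj ?p"
  have "?n \<noteq> 0"
  proof
    assume "?n = 0"
    then have "qRe ?p = 0 \<and> qI ?p = 0 \<and> qJ ?p = 0 \<and> qK ?p = 0"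
      by (smt (verit) zero_le_power2 power2_eq_square mult_eq_0_iff)
    then show False using h by (simp add: quat.expand)
  qed
  then have v: "v * ?p = 1" "?p * v = 1"
    by (auto simp: v_def qcnj_def quat.expand power2_eq_square field_simps intro!: quat.expand)
  have "DQuat v (- (v * dual h * v)) * h = 1" "h * DQuat v (- (v * dual h * v)) = 1"
    using v by (auto intro!: dquat.expand simp: mult.assoc) (simp add: mult.assoc[symmetric])
  then show "\<exists>u. u * h = 1 \<and> h * u = 1" by blast
qed

lemma dquat_in_Reals_iff: "h \<in> \<real> \<longleftrightarrow> primal h \<in> \<real> \<and> dual h = 0"
proof
  assume "h \<in> \<real>"
  then obtain r where "h = of_real r" by (auto elim: Reals_cases)
  then show "primal h \<in> \<real> \<and> dual h = 0"
    by (simp add: of_real_def) (metis Reals_of_real of_real_def)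
next
  assume h: "primal h \<in> \<real> \<and> dual h = 0"
  then obtain r where "primal h = of_real r" by (auto elim: Reals_cases)
  with h have "h = of_real r" by (auto simp: of_real_def intro!: dquat.expand)
  then show "h \<in> \<real>" by simp
qed

lemma quat_in_Reals_iff: "x \<in> \<real> \<longleftrightarrow> qcnj x = x"
proof
  assume "x \<in> \<real>"
  then show "qcnj x = x" by (auto elim!: Reals_cases simp: quat_of_real qcnj_def)
next
  assume "qcnj x = x"
  then have "x = of_real (qRe x)"
    by (cases x) (auto simp: quat_of_real qcnj_def)
  then show "x \<in> \<real>" by (metis Reals_of_real)
qed

lemma qcnj_simps [simp]:
  "qcnj 0 = 0" "qcnj (x + y) = qcnj x + qcnj y" "qcnj (x * y) = qcnj y * qcnj x"
  "qcnj (qcnj x) = x"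
  by (simp_all add: qcnj_def quat.expand algebra_simps)

lemma dcnj_simps [simp]:
  "dcnj 0 = 0" "primal (dcnj h) = qcnj (primal h)" "dual (dcnj h) = qcnj (dual h)"
  by (simp_all add: dcnj_def dquat.expand)

lemma qcnj_sum: "qcnj (sum f A) = (\<Sum>i\<in>A. qcnj (f i))"
  by (induction A rule: infinite_finite_induct) auto

lemma dquat_sum:
  "primal (sum f A) = (\<Sum>i\<in>A. primal (f i))" "dual (sum f A) = (\<Sum>i\<in>A. dual (f i))"
  by (induction A rule: infinite_finite_induct) auto

lemma quat_sum:
  "qRe (sum f A) = (\<Sum>i\<in>A. qRe (f i))" "qI (sum f A) = (\<Sum>i\<in>A. qI (f i))"
  "qJ (sum f A) = (\<Sum>i\<in>A. qJ (f i))" "qK (sum f A) = (\<Sum>i\<in>A. qK (f i))"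
  by (induction A rule: infinite_finite_induct) auto

lemma real_coeffs_iff:
  "(\<forall>i. coeff (C \<otimes> map_poly dcnj C) i \<in> \<real>) \<longleftrightarrow>
     primal_part C \<otimes> pcnj (dual_part C) + dual_part C \<otimes> pcnj (primal_part C) = 0"
proof -
  have "primal (coeff (C \<otimes> map_poly dcnj C) i) \<in> \<real>" for i
  proof -
    let ?f = "\<lambda>j. primal (coeff C j) * qcnj (primal (coeff C (i - j)))"
    have eq: "primal (coeff (C \<otimes> map_poly dcnj C) i) = (\<Sum>j\<le>i. ?f j)"
      by (simp add: coeff_ncmult dquat_sum coeff_map_poly)
    have "qcnj (\<Sum>j\<le>i. ?f j) = (\<Sum>j\<le>i. ?f (i - j))"
      by (auto simp: qcnj_sum intro!: sum.cong)
    also have "\<dots> = (\<Sum>j\<le>i. ?f j)"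
      by (rule sum.nat_diff_reindex[where n = "Suc i", simplified lessThan_Suc_atMost, simplified])
    finally show ?thesis by (simp add: eq quat_in_Reals_iff)
  qed
  moreover have "dual (coeff (C \<otimes> map_poly dcnj C) i) =
      coeff (primal_part C \<otimes> pcnj (dual_part C) + dual_part C \<otimes> pcnj (primal_part C)) i" for i
    by (simp add: coeff_ncmult dquat_sum coeff_map_poly sum.distrib)
  ultimately show ?thesis
    by (simp add: dquat_in_Reals_iff poly_eq_iff)
qed

lemma quat_poly_eqI:
  assumes "map_poly qRe X = map_poly qRe Y" "map_poly qI X = map_poly qI Y"
    "map_poly qJ X = map_poly qJ Y" "map_poly qK X = map_poly qK Y"
  shows "X = Y"
proof (rule poly_eqI)
  fix n
  show "coeff X n = coeff Y n"
    using assms[THEN arg_cong[where f = "\<lambda>p. coeff p n"]]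
    by (auto simp: coeff_map_poly intro: quat.expand)
qed

lemma coords_of_coords [simp]:
  "map_poly qRe (of_coords a b c d) = a" "map_poly qI (of_coords a b c d) = b"
  "map_poly qJ (of_coords a b c d) = c" "map_poly qK (of_coords a b c d) = d"
  by (simp_all add: of_coords_def poly_eq_iff coeff_map_poly)

lemma coords_real_poly_ncmult [simp]:
  "map_poly qRe (real_poly g \<otimes> X) = g * map_poly qRe X"
  "map_poly qI (real_poly g \<otimes> X) = g * map_poly qI X"
  "map_poly qJ (real_poly g \<otimes> X) = g * map_poly qJ X"
  "map_poly qK (real_poly g \<otimes> X) = g * map_poly qK X"
  by (simp_all add: poly_eq_iff coeff_map_poly coeff_ncmult coeff_mult quat_sum quat_of_real)

lemma reduce_eqn:
  assumes "X \<noteq> 0"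
  shows "X = real_poly (coord_gcd X) \<otimes> reduce_eqn X" and "coord_gcd (reduce_eqn X) = 1"
proof -
  let ?g = "coord_gcd X"
  have dvd: "?g dvd map_poly qRe X" "?g dvd map_poly qI X" "?g dvd map_poly qJ X"
    "?g dvd map_poly qK X"
    unfolding coord_gcd_def by (meson dvd_trans gcd_dvd1 gcd_dvd2)+
  show *: "X = real_poly ?g \<otimes> reduce_eqn X"
    by (rule quat_poly_eqI) (simp_all add: reduce_eqn_def dvd)
  have "?g \<noteq> 0"
    using assms quat_poly_eqI[of X 0] by (auto simp: coord_gcd_def)
  have norm: "normalize ?g = ?g"
    by (simp add: coord_gcd_def)
  have "coord_gcd (real_poly ?g \<otimes> reduce_eqn X) = ?g * coord_gcd (reduce_eqn X)"
    by (simp add: coord_gcd_def[of "_ \<otimes> _"] coord_gcd_def[of "reduce_eqn _"]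
        gcd_mult_left norm normalize_mult)
  with * have "?g * coord_gcd (reduce_eqn X) = ?g" by simp
  then show "coord_gcd (reduce_eqn X) = 1"
    using \<open>?g \<noteq> 0\<close> by simp
qed

end

theory Submission imports Defs begin

text \<open>
  Write \<open>C = P + \<epsilon> Q\<close> and split off the maximal real factor: \<open>P = g P'\<close> with \<open>deg g = m\<close> and
  \<open>P'\<close> primitive, that is, without real factor of positive degree. Let \<open>\<nu> = P' pcnj(P')\<close>, a real
  polynomial of degree \<open>2 (n - m)\<close>. Since real polynomials are central, \<open>g\<close> can be pulled out of
  the whole trajectory, which becomes \<open>g P' W\<close> with \<open>W = g x pcnj(P') + 2 x\<^sub>0 pcnj(Q)\<close> of degree at
  most \<open>n\<close> (\<open>trajectory_factorization\<close>). If the reduced equation \<open>Z\<close> of the trajectory is defined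
  by \<open>P' W = h Z\<close>, then \<open>d = deg Z \<le> 2 n - m - deg h\<close>, and this contains the degree bound.

  For the circularity it remains to see that \<open>\<nu>\<close> divides \<open>h gcd(Z\<^sub>0, S)\<close>, where \<open>Z\<^sub>0\<close> is the real
  coordinate of \<open>Z\<close> and \<open>S\<close> the sum of the squares of the others: comparing degrees then gives
  \<open>2 (n - m) \<le> deg h + 2 c\<close>, and the deficit \<open>deg h\<close> is exactly what has been gained in the
  estimate of \<open>d\<close>, so \<open>d - m \<le> 2 c\<close>.

  The motion condition makes the real coordinate of the trajectory equal to
  \<open>x\<^sub>0 P pcnj(P) = x\<^sub>0 g\<^sup>2 \<nu>\<close> (\<open>trajectory_real_coordinate\<close>); hence \<open>h Z\<^sub>0 = x\<^sub>0 g \<nu>\<close> is a multiple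
  of \<open>\<nu>\<close>. The norm \<open>Z\<^sub>0\<^sup>2 + S\<close> of \<open>Z\<close> needs more care, as multiplicativity of the norm only
  shows that \<open>\<nu>\<close> divides \<open>h\<^sup>2 (Z\<^sub>0\<^sup>2 + S)\<close>, with one factor \<open>h\<close> too many. But
  \<open>h (Z\<^sub>0\<^sup>2 + S) = h Z pcnj(Z) = P' (W pcnj(Z))\<close> is a real right multiple of \<open>P'\<close>, and a real right
  multiple of a primitive quaternion polynomial is divisible by its norm
  (\<open>norm_poly_dvd_real_multiple\<close>).
\<close>

section \<open>The algebra of quaternion polynomials\<close>

text \<open>
  The type \<open>quat poly\<close> carries no ring structure for \<open>\<otimes>\<close>. Coordinates reduce every identity for
  this product to one in the commutative ring of real polynomials.
\<close>

lemma coords_simps: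
  "map_poly qRe (X + Y) = map_poly qRe X + map_poly qRe Y"
  "map_poly qI (X + Y) = map_poly qI X + map_poly qI Y"
  "map_poly qJ (X + Y) = map_poly qJ X + map_poly qJ Y"
  "map_poly qK (X + Y) = map_poly qK X + map_poly qK Y"
  "map_poly qRe (pcnj X) = map_poly qRe X"
  "map_poly qI (pcnj X) = - map_poly qI X"
  "map_poly qJ (pcnj X) = - map_poly qJ X"
  "map_poly qK (pcnj X) = - map_poly qK X"
  "map_poly qRe (real_poly F) = F"
  "map_poly qI (real_poly F) = 0"
  "map_poly qJ (real_poly F) = 0"
  "map_poly qK (real_poly F) = 0"
  by (simp_all add: poly_eq_iff coeff_map_poly quat_of_real qcnj_def)

lemma coords_ncmult:
  "map_poly qRe (X \<otimes> Y) = map_poly qRe X * map_poly qRe Y - map_poly qI X * map_poly qI Y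
     - map_poly qJ X * map_poly qJ Y - map_poly qK X * map_poly qK Y"
  "map_poly qI (X \<otimes> Y) = map_poly qRe X * map_poly qI Y + map_poly qI X * map_poly qRe Y
     + map_poly qJ X * map_poly qK Y - map_poly qK X * map_poly qJ Y"
  "map_poly qJ (X \<otimes> Y) = map_poly qRe X * map_poly qJ Y - map_poly qI X * map_poly qK Y
     + map_poly qJ X * map_poly qRe Y + map_poly qK X * map_poly qI Y"
  "map_poly qK (X \<otimes> Y) = map_poly qRe X * map_poly qK Y + map_poly qI X * map_poly qJ Y
     - map_poly qJ X * map_poly qI Y + map_poly qK X * map_poly qRe Y"
  by (simp_all add: poly_eq_iff coeff_map_poly coeff_ncmult coeff_mult quat_sum
      sum.distrib sum_subtractf)

lemma ncmult_assoc: "X \<otimes> Y \<otimes> Z = X \<otimes> (Y \<otimes> Z)" for X Y Z :: "quat poly"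
  by (rule quat_poly_eqI) (simp_all add: coords_ncmult algebra_simps)

lemma ncmult_add_right: "X \<otimes> (Y + Z) = X \<otimes> Y + X \<otimes> Z" for X Y Z :: "quat poly"
  by (rule quat_poly_eqI) (simp_all add: coords_ncmult coords_simps algebra_simps)

lemma real_poly_central: "X \<otimes> real_poly F = real_poly F \<otimes> X" for X :: "quat poly"
  by (rule quat_poly_eqI) (simp_all add: coords_ncmult coords_simps algebra_simps)

lemma real_poly_left_commute: "X \<otimes> (real_poly F \<otimes> Y) = real_poly F \<otimes> (X \<otimes> Y)"
  for X Y :: "quat poly"
  by (metis ncmult_assoc real_poly_central)

lemma real_poly_mult: "real_poly (F * G) = (real_poly F \<otimes> real_poly G :: quat poly)"
  by (rule quat_poly_eqI) (simp_all add: coords_simps)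

lemma pcnj_real_poly_ncmult: "pcnj (real_poly F \<otimes> X) = real_poly F \<otimes> pcnj X"
  by (rule quat_poly_eqI) (simp_all add: coords_simps)

lemma real_poly_left_cancel:
  fixes X Y :: "quat poly"
  assumes "real_poly F \<otimes> X = real_poly F \<otimes> Y" and "F \<noteq> 0"
  shows "X = Y"
  using assms(1)[THEN arg_cong[where f = "map_poly qRe"]]
    assms(1)[THEN arg_cong[where f = "map_poly qI"]]
    assms(1)[THEN arg_cong[where f = "map_poly qJ"]]
    assms(1)[THEN arg_cong[where f = "map_poly qK"]] assms(2)
  by (intro quat_poly_eqI) simp_all

section \<open>The norm polynomial\<close>

definition norm_poly :: "quat poly \<Rightarrow> real poly" where
  "norm_poly X =
     (map_poly qRe X)\<^sup>2 + (map_poly qI X)\<^sup>2 + (map_poly qJ X)\<^sup>2 + (map_poly qK X)\<^sup>2"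

lemma ncmult_pcnj: "X \<otimes> pcnj X = real_poly (norm_poly X)"
  by (rule quat_poly_eqI)
    (simp_all add: norm_poly_def coords_ncmult coords_simps power2_eq_square algebra_simps)

lemma pcnj_ncmult_self: "pcnj X \<otimes> X = real_poly (norm_poly X)"
  by (rule quat_poly_eqI)
    (simp_all add: norm_poly_def coords_ncmult coords_simps power2_eq_square algebra_simps)

lemma norm_poly_ncmult: "norm_poly (X \<otimes> Y) = norm_poly X * norm_poly Y"
  by (simp add: norm_poly_def coords_ncmult power2_eq_square algebra_simps)

lemma norm_poly_pcnj: "norm_poly (pcnj X) = norm_poly X"
  by (simp add: norm_poly_def coords_simps)

lemma norm_poly_real_poly: "norm_poly (real_poly F) = F\<^sup>2"
  by (simp add: norm_poly_def coords_simps)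

lemma degree_map_poly_le_of_zero: "f 0 = 0 \<Longrightarrow> degree (map_poly f X) \<le> degree X"
  by (rule degree_le) (simp add: coeff_map_poly coeff_eq_0)

lemma degree_coords_le:
  "degree (map_poly qRe X) \<le> degree X" "degree (map_poly qI X) \<le> degree X"
  "degree (map_poly qJ X) \<le> degree X" "degree (map_poly qK X) \<le> degree X"
  by (simp_all add: degree_map_poly_le_of_zero)

lemma coeff_power2_at_double:
  fixes F :: "real poly"
  assumes "degree F \<le> k"
  shows "coeff (F\<^sup>2) (2 * k) = (coeff F k)\<^sup>2"
proof (cases "degree F = k")
  case True
  then show ?thesis
    using coeff_mult_degree_sum[of F F] by (simp add: power2_eq_square mult_2)
next
  case False
  with assms have lt: "degree F < k" by simp
  moreover have "degree (F\<^sup>2) < 2 * k"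
    using lt degree_mult_le[of F F] by (simp add: power2_eq_square)
  ultimately show ?thesis by (simp add: coeff_eq_0)
qed

text \<open>
  The leading coefficients of squares cannot cancel over the reals. As the norm is also
  multiplicative, this carries the absence of zero divisors and the additivity of degrees from
  real polynomials over to quaternion polynomials.
\<close>

lemma degree_norm_poly: "degree (norm_poly X) = 2 * degree X"
proof (cases "X = 0")
  case False
  let ?l = "lead_coeff X"
  have "coeff (norm_poly X) (2 * degree X) = (qRe ?l)\<^sup>2 + (qI ?l)\<^sup>2 + (qJ ?l)\<^sup>2 + (qK ?l)\<^sup>2"
    by (simp add: norm_poly_def coeff_power2_at_double degree_coords_le coeff_map_poly)
  moreover have "?l \<noteq> 0" using False by simp
  then have "qRe ?l \<noteq> 0 \<or> qI ?l \<noteq> 0 \<or> qJ ?l \<noteq> 0 \<or> qK ?l \<noteq> 0"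
    by (metis quat.collapse Quat_0)
  then have "(qRe ?l)\<^sup>2 + (qI ?l)\<^sup>2 + (qJ ?l)\<^sup>2 + (qK ?l)\<^sup>2 \<noteq> 0"
    by (auto simp: add_nonneg_eq_0_iff)
  ultimately have "2 * degree X \<le> degree (norm_poly X)"
    by (simp add: le_degree)
  moreover have "degree (F\<^sup>2) \<le> 2 * degree X" if "degree F \<le> degree X" for F :: "real poly"
    using that degree_mult_le[of F F] by (simp add: power2_eq_square)
  then have "degree (norm_poly X) \<le> 2 * degree X"
    unfolding norm_poly_def by (intro degree_add_le degree_coords_le) (auto simp: degree_coords_le)
  ultimately show ?thesis by simp
qed (simp add: norm_poly_def)

lemma norm_poly_eq_0_iff: "norm_poly X = 0 \<longleftrightarrow> X = 0"
proof
  assume X: "norm_poly X = 0"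
  then have "degree X = 0" using degree_norm_poly[of X] by simp
  then obtain a where a: "X = [:a:]" by (rule degree_eq_zeroE)
  have "(qRe a)\<^sup>2 + (qI a)\<^sup>2 + (qJ a)\<^sup>2 + (qK a)\<^sup>2 = 0"
    using X by (simp add: a norm_poly_def map_poly_pCons power2_eq_square)
  then have "qRe a = 0 \<and> qI a = 0 \<and> qJ a = 0 \<and> qK a = 0"
    by (auto simp: add_nonneg_eq_0_iff)
  then show "X = 0" using a by (metis quat.collapse Quat_0 pCons_0_0)
qed (simp add: norm_poly_def)

lemma ncmult_eq_0_iff: "X \<otimes> Y = 0 \<longleftrightarrow> X = 0 \<or> Y = 0" for X Y :: "quat poly"
  by (metis norm_poly_eq_0_iff norm_poly_ncmult mult_eq_0_iff)

lemma degree_ncmult: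
  fixes X Y :: "quat poly"
  assumes "X \<noteq> 0" "Y \<noteq> 0"
  shows "degree (X \<otimes> Y) = degree X + degree Y"
proof -
  have "2 * degree (X \<otimes> Y) = 2 * degree X + 2 * degree Y"
    using assms by (simp flip: degree_norm_poly add: norm_poly_ncmult degree_mult_eq norm_poly_eq_0_iff)
  then show ?thesis by simp
qed

lemma degree_ncmult_le: "degree (X \<otimes> Y) \<le> degree X + degree Y" for X Y :: "quat poly"
  by (cases "X = 0 \<or> Y = 0") (auto simp: degree_ncmult ncmult_eq_0_iff[THEN iffD2])

lemma degree_real_poly: "degree (real_poly F :: quat poly) = degree F"
  by (rule degree_map_poly) simp

lemma degree_pcnj: "degree (pcnj X) = degree X"
  by (rule degree_map_poly) (simp add: qcnj_def quat.expand, metis Quat_0 neg_equal_0_iff_equal quat.collapse quat.sel)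

section \<open>Real factors\<close>

text \<open>
  The real factors of a quaternion polynomial are the common divisors of its coordinates. Hence
  \<open>coord_gcd P\<close> serves as a maximal real factor that comes with the primitive cofactor
  \<open>reduce_eqn P\<close>.
\<close>

lemma dvd_coord_gcd_iff:
  "F dvd coord_gcd X \<longleftrightarrow>
     F dvd map_poly qRe X \<and> F dvd map_poly qI X \<and> F dvd map_poly qJ X \<and> F dvd map_poly qK X"
  by (auto simp: coord_gcd_def)

lemma coord_gcd_real_poly_ncmult: "coord_gcd (real_poly F \<otimes> X) = normalize F * coord_gcd X"
proof -
  have "gcd (F * G) (normalize F * H) = normalize F * gcd G H" for G H
    using gcd_mult_left[of F G H] gcd.normalize_right_idem[of "F * G" "F * H"]
      gcd.normalize_right_idem[of "F * G" "normalize F * H"]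
    by (simp add: normalize_mult)
  then show ?thesis
    by (simp add: coord_gcd_def gcd_mult_left normalize_mult)
qed

lemma real_factor_iff_dvd_coord_gcd: "real_factor F P \<longleftrightarrow> F dvd coord_gcd P"
proof
  assume "F dvd coord_gcd P"
  then have "P = real_poly F \<otimes> of_coords (map_poly qRe P div F) (map_poly qI P div F)
      (map_poly qJ P div F) (map_poly qK P div F)"
    by (intro quat_poly_eqI) (simp_all add: dvd_coord_gcd_iff)
  then show "real_factor F P" by (auto simp: real_factor_def)
qed (auto simp: real_factor_def dvd_coord_gcd_iff)

lemma coord_gcd_nonzero: "X \<noteq> 0 \<Longrightarrow> coord_gcd X \<noteq> 0"
  using quat_poly_eqI[of X 0] by (auto simp: coord_gcd_def)

lemma degree_mrpf:
  assumes "P \<noteq> 0"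
  shows "degree (mrpf P) = degree (coord_gcd P)"
proof -
  have bound: "degree F < Suc (degree (coord_gcd P))" if "real_factor F P" for F
    using that coord_gcd_nonzero[OF assms]
    by (simp add: real_factor_iff_dvd_coord_gcd dvd_imp_degree_le less_Suc_eq_le)
  have max: "real_factor (coord_gcd P) P"
    by (simp add: real_factor_iff_dvd_coord_gcd)
  have "real_factor (mrpf P) P"
    unfolding mrpf_def
    by (rule arg_max_natI[where P = "\<lambda>F. real_factor F P", OF max]) (use bound in blast)
  moreover have "degree (coord_gcd P) \<le> degree (mrpf P)"
    unfolding mrpf_def
    by (rule arg_max_nat_le[where P = "\<lambda>F. real_factor F P", OF max]) (use bound in blast)
  ultimately show ?thesis
    using bound by (simp add: less_Suc_eq_le order_antisym)
qed

text \<open>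
  Multiplying \<open>P \<otimes> K = H\<close> by \<open>pcnj P\<close> from the left gives \<open>norm_poly P \<otimes> K = H \<otimes> pcnj P\<close>. So the
  norm divides every coordinate of \<open>P\<close> up to the factor \<open>H\<close>, and these coordinates have gcd 1.
\<close>

lemma norm_poly_dvd_real_multiple:
  assumes "P \<otimes> K = real_poly H" and "coord_gcd P = 1"
  shows "norm_poly P dvd H"
proof -
  have "real_poly (norm_poly P) \<otimes> K = real_poly H \<otimes> pcnj P"
    by (metis assms(1) ncmult_assoc pcnj_ncmult_self real_poly_central)
  then have "real_factor (norm_poly P) (real_poly H \<otimes> pcnj P)"
    by (metis real_factor_def)
  then have "norm_poly P dvd coord_gcd (real_poly H \<otimes> P)"
    by (simp add: real_factor_iff_dvd_coord_gcd dvd_coord_gcd_iff coords_simps)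
  also have "coord_gcd (real_poly H \<otimes> P) = normalize H * coord_gcd P"
    by (rule coord_gcd_real_poly_ncmult)
  finally show ?thesis using assms(2) by simp
qed

text \<open>
  Cancelling a real factor \<open>h\<close> from a product \<open>P \<otimes> W\<close> divides the norm of the product by \<open>h\<^sup>2\<close>,
  but at most the factor \<open>h\<close> is lost from the divisor \<open>norm_poly P\<close> of that norm.
\<close>

lemma norm_poly_dvd_of_real_factor:
  assumes "P \<otimes> W = real_poly h \<otimes> Z" and "coord_gcd P = 1"
  shows "norm_poly P dvd h * norm_poly Z"
proof (rule norm_poly_dvd_real_multiple)
  show "P \<otimes> (W \<otimes> pcnj Z) = real_poly (h * norm_poly Z)"
    by (metis assms(1) ncmult_assoc ncmult_pcnj real_poly_mult)
qed (fact assms(2))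

section \<open>Trajectories\<close>

lemma curve_degree_eq: "curve_degree X = degree (reduce_eqn X)"
proof -
  let ?Y = "reduce_eqn X"
  let ?d = "curve_degree X"
  have le: "degree (map_poly qRe ?Y) \<le> ?d" "degree (map_poly qI ?Y) \<le> ?d"
    "degree (map_poly qJ ?Y) \<le> ?d" "degree (map_poly qK ?Y) \<le> ?d"
    by (simp_all add: curve_degree_def Let_def)
  have "coeff ?Y i = 0" if "i > ?d" for i
  proof -
    have "coeff (map_poly qRe ?Y) i = 0" "coeff (map_poly qI ?Y) i = 0"
      "coeff (map_poly qJ ?Y) i = 0" "coeff (map_poly qK ?Y) i = 0"
      using le that by (auto intro!: coeff_eq_0)
    then show ?thesis
      by (simp add: coeff_map_poly) (metis Quat_0 quat.collapse)
  qed
  then have "degree ?Y \<le> ?d" by (simp add: degree_le)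
  moreover have "?d \<le> degree ?Y"
    by (simp add: curve_degree_def Let_def degree_coords_le)
  ultimately show ?thesis by simp
qed

lemma motion_polynomial_degrees:
  assumes "motion_polynomial C"
  shows "primal_part C \<noteq> 0" "degree (primal_part C) = degree C" "degree (dual_part C) \<le> degree C"
proof -
  have "coeff (primal_part C) (degree C) \<noteq> 0"
    using assms by (simp add: motion_polynomial_def invertible_dquat_iff coeff_map_poly)
  then show "primal_part C \<noteq> 0" "degree (primal_part C) = degree C"
    using degree_map_poly_le_of_zero[of primal C] le_degree[of "primal_part C"]
    by (auto intro: order_antisym)
  show "degree (dual_part C) \<le> degree C" by (simp add: degree_map_poly_le_of_zero)
qed

lemma trajectory_eq:
  "trajectory C x = primal_part C \<otimes> ([:x:] \<otimes> pcnj (primal_part C)) +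
     real_poly [:2 * qRe x:] \<otimes> (primal_part C \<otimes> pcnj (dual_part C))"
  by (simp add: trajectory_def Let_def ncmult_assoc map_poly_pCons)

text \<open>
  The first summand of the trajectory contains the real factor \<open>g\<close> twice and the second one only
  once, which is why one \<open>g\<close> stays inside the parentheses.
\<close>

lemma trajectory_factorization:
  assumes "primal_part C = real_poly g \<otimes> P"
  shows "trajectory C x = real_poly g \<otimes> (P \<otimes>
     (real_poly g \<otimes> ([:x:] \<otimes> pcnj P) + real_poly [:2 * qRe x:] \<otimes> pcnj (dual_part C)))"
proof -
  have "[:x:] \<otimes> pcnj (primal_part C) = real_poly g \<otimes> ([:x:] \<otimes> pcnj P)"
    by (simp add: assms pcnj_real_poly_ncmult real_poly_left_commute[of "[:x:]" g])
  moreover have "real_poly r \<otimes> (real_poly g \<otimes> P \<otimes> Y) = real_poly g \<otimes> (P \<otimes> (real_poly r \<otimes> Y))"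
    for r Y
    by (metis ncmult_assoc real_poly_left_commute)
  ultimately show ?thesis
    unfolding trajectory_eq by (simp only: assms ncmult_assoc ncmult_add_right)
qed

text \<open>
  By the motion condition \<open>P \<otimes> pcnj Q\<close> is the negative of its own conjugate, so the translational
  part of the trajectory has no real coordinate.
\<close>

lemma trajectory_real_coordinate:
  assumes "motion_polynomial C"
  shows "map_poly qRe (trajectory C x) = [:qRe x:] * norm_poly (primal_part C)"
proof -
  let ?P = "primal_part C" and ?Q = "dual_part C"
  have "map_poly qRe (?P \<otimes> pcnj ?Q + ?Q \<otimes> pcnj ?P) = 0"
    using assms by (simp add: motion_polynomial_def real_coeffs_iff)
  then have "2 * map_poly qRe (?P \<otimes> pcnj ?Q) = 0"
    by (simp add: coords_simps coords_ncmult algebra_simps)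
  then have PQ: "map_poly qRe (?P \<otimes> pcnj ?Q) = 0" by simp
  have "map_poly qRe (?P \<otimes> ([:x:] \<otimes> pcnj ?P)) = [:qRe x:] * norm_poly ?P"
    by (simp add: coords_ncmult coords_simps norm_poly_def map_poly_pCons power2_eq_square
        algebra_simps)
  moreover have "map_poly qRe (real_poly [:2 * qRe x:] \<otimes> (?P \<otimes> pcnj ?Q)) = 0"
    by (simp only: coords_real_poly_ncmult PQ mult_zero_right)
  ultimately show ?thesis
    unfolding trajectory_eq by (simp only: coords_simps(1) add_0_right)
qed

text \<open>
  For a finite point the real coordinate already shows this; for a point at infinity the
  trajectory is a product of non-zero polynomials.
\<close>

lemma trajectory_nonzero:
  assumes "motion_polynomial C" and "x \<noteq> 0"
  shows "trajectory C x \<noteq> 0"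
proof (cases "qRe x = 0")
  case True
  then have "real_poly [:2 * qRe x:] \<otimes> (primal_part C \<otimes> pcnj (dual_part C)) = 0"
    by (simp add: ncmult_eq_0_iff)
  then have "trajectory C x = primal_part C \<otimes> ([:x:] \<otimes> pcnj (primal_part C))"
    unfolding trajectory_eq by simp
  moreover have "pcnj (primal_part C) \<noteq> 0"
    using motion_polynomial_degrees(1)[OF assms(1)]
    by (metis norm_poly_pcnj norm_poly_eq_0_iff)
  ultimately show ?thesis
    using assms(2) motion_polynomial_degrees(1)[OF assms(1)] by (simp add: ncmult_eq_0_iff)
next
  case False
  then have "map_poly qRe (trajectory C x) \<noteq> 0"
    using motion_polynomial_degrees(1)[OF assms(1)]
    by (simp add: trajectory_real_coordinate[OF assms(1)] norm_poly_eq_0_iff del: mult_pCons_left)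
  then show ?thesis by auto
qed

theorem theorem1:
  fixes C :: "dquat poly" and x :: quat and n m d :: nat and c :: real
  assumes "reduced_motion_polynomial C"
    and "degree C = n"
    and "spherical_degree_defect C = m"
    and "x \<noteq> 0"
    and "curve_degree (trajectory C x) = d"
    and "curve_circularity (trajectory C x) = c"
  shows "real d \<le> 2 * real n - real m \<and> c \<ge> (real d - real m) / 2"
proof -
  have motion: "motion_polynomial C"
    using assms(1) by (simp add: reduced_motion_polynomial_def)
  define X where "X = trajectory C x"
  define Z where "Z = reduce_eqn X"
  define g where "g = coord_gcd (primal_part C)"
  define P where "P = reduce_eqn (primal_part C)"
  define W where "W = real_poly g \<otimes> ([:x:] \<otimes> pcnj P) +
    real_poly [:2 * qRe x:] \<otimes> pcnj (dual_part C)"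
  note C0 = motion_polynomial_degrees[OF motion, unfolded assms(2)]
  have gP: "primal_part C = real_poly g \<otimes> P" and P1: "coord_gcd P = 1"
    using reduce_eqn[OF C0(1)] by (simp_all add: g_def P_def)
  have g0: "g \<noteq> 0" and gm: "degree g = m"
    using coord_gcd_nonzero[OF C0(1)] degree_mrpf[OF C0(1)] assms(3)
    by (simp_all add: g_def spherical_degree_defect_def)
  have P0: "P \<noteq> 0" using gP C0(1) by (auto simp: ncmult_eq_0_iff)
  have n: "n = m + degree P"
    using degree_ncmult[of "real_poly g" P] P0 g0 C0(2) gm
    by (simp add: gP degree_real_poly map_poly_eq_0_iff)
  have X0: "X \<noteq> 0" unfolding X_def using trajectory_nonzero[OF motion assms(4)] .
  have XY: "X = real_poly g \<otimes> (P \<otimes> W)"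
    unfolding X_def W_def using trajectory_factorization[OF gP] .
  have XZ: "X = real_poly (coord_gcd X) \<otimes> Z"
    using reduce_eqn(1)[OF X0] by (simp add: Z_def)
  have "g dvd coord_gcd X"
    using XY real_factor_iff_dvd_coord_gcd[of g X] by (auto simp: real_factor_def)
  then obtain h where h: "coord_gcd X = g * h" ..
  have PW: "P \<otimes> W = real_poly h \<otimes> Z"
    by (rule real_poly_left_cancel[OF _ g0]) (metis XY XZ h ncmult_assoc real_poly_mult)
  have "P \<otimes> W \<noteq> 0" using X0 by (simp add: XY ncmult_eq_0_iff)
  then have W0: "W \<noteq> 0" by (simp add: ncmult_eq_0_iff)
  have h0: "h \<noteq> 0" and Z0: "Z \<noteq> 0"
    using \<open>P \<otimes> W \<noteq> 0\<close> by (auto simp: PW ncmult_eq_0_iff)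
  have d: "degree Z = d"
    using assms(5) by (simp add: curve_degree_eq X_def Z_def)
  have degs: "degree P + degree W = degree h + d"
    using arg_cong[OF PW, of degree] P0 W0 h0 Z0 d
    by (simp add: degree_ncmult degree_real_poly map_poly_eq_0_iff)
  have "degree W \<le> n"
    unfolding W_def
  proof (rule degree_add_le)
    show "degree (real_poly g \<otimes> ([:x:] \<otimes> pcnj P)) \<le> n"
      using degree_ncmult_le[of "real_poly g" "[:x:] \<otimes> pcnj P"] degree_ncmult_le[of "[:x:]" "pcnj P"]
      by (simp add: degree_real_poly degree_pcnj gm n)
    show "degree (real_poly [:2 * qRe x:] \<otimes> pcnj (dual_part C)) \<le> n"
      using degree_ncmult_le[of "real_poly [:2 * qRe x:]" "pcnj (dual_part C)"] C0(3)
      by (simp only: degree_real_poly degree_pcnj degree_pCons_0)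
  qed
  with degs n have deg_le: "d + degree h + m \<le> 2 * n" by simp

  \<comment> \<open>It remains to bound \<open>degree (norm_poly P) = 2 * (n - m)\<close> by \<open>degree h + 2 * c\<close>.\<close>
  define \<nu> where "\<nu> = norm_poly P"
  define z where "z = map_poly qRe Z"
  define S where "S = (map_poly qI Z)\<^sup>2 + (map_poly qJ Z)\<^sup>2 + (map_poly qK Z)\<^sup>2"
  have norm_Z: "norm_poly Z = z * z + S"
    by (simp add: norm_poly_def z_def S_def power2_eq_square)
  have "map_poly qRe X = g * (h * z)"
    unfolding XY PW by (simp add: z_def)
  moreover have "map_poly qRe X = [:qRe x:] * (g\<^sup>2 * \<nu>)"
    using trajectory_real_coordinate[OF motion, of x]
    by (simp only: X_def \<nu>_def gP norm_poly_ncmult norm_poly_real_poly)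
  ultimately have "g * (h * z) = g * ([:qRe x:] * g * \<nu>)"
    by (simp only: power2_eq_square ac_simps)
  then have "h * z = [:qRe x:] * g * \<nu>" using g0 by (simp only: mult_cancel_left simp_thms)
  then have z: "\<nu> dvd h * z" by (metis dvd_triv_right)
  have "\<nu> dvd h * norm_poly Z"
    unfolding \<nu>_def using norm_poly_dvd_of_real_factor[OF PW P1] .
  then have "\<nu> dvd h * z * z + h * S"
    by (simp add: norm_Z algebra_simps)
  with z have S: "\<nu> dvd h * S" by (meson dvd_add_right_iff dvd_mult2)
  have "\<nu> dvd h * gcd z S"
    using z S by (metis dvd_normalize_iff gcd_greatest gcd_mult_left)
  moreover have "gcd z S \<noteq> 0"
    using norm_Z Z0 norm_poly_eq_0_iff[of Z] by auto
  ultimately have "degree \<nu> \<le> degree h + degree (gcd z S)"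
    using h0 by (metis degree_mult_eq dvd_imp_degree_le mult_eq_0_iff)
  then have "2 * degree P \<le> degree h + degree (gcd z S)"
    by (simp add: \<nu>_def degree_norm_poly)
  moreover have "2 * c = real (degree (gcd z S))"
    using assms(6) by (simp add: curve_circularity_def Let_def X_def Z_def z_def S_def)
  ultimately show ?thesis using deg_le n by simp
qed

end
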